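(* Let $\omega$ and $\sigma$ be weight functions with $\omega(t)=o(t^2)$ and $\sigma(t)=o(t^2)$ as $t\to\infty$. Then the following are equivalent: (i) $\omega\preceq\sigma$, i.e. $\sigma(t)=O(\omega(t))$ as $t\to\infty$; (ii) $\mathcal{S}_{(\omega)}(\mathbb{R}^d)\subseteq\mathcal{S}_{(\sigma)}(\mathbb{R}^d)$ holds for all dimensions $d\in\mathbb{N}$ with continuous inclusion. More precisely, the spaces in (ii) can be defined by joint or separated growth at infinity; (i)$\Rightarrow$(ii) is valid for general weight functions $\omega$ and $\sigma$; and for (ii)$\Rightarrow$(i) only the inclusion for $d=1$ is required.
   Context: $\mathbb{N}_0=\mathbb{N}\cup\{0\}$. A weight function is a continuous increasing (i.e. nondecreasing) function $\omega:[0,+\infty)\to[0,+\infty)$ such that: $(\alpha)$ there is $L\ge 1$ with $\omega(2t)\le L(\omega(t)+1)$ for all $t\ge 0$; $(\beta)$ $\omega(t)=O(t^2)$ as $t\to+\infty$; $(\gamma)$ $\log t=o(\omega(t))$ as $t\to+\infty$; $(\delta)$ $\varphi_\omega(t):=\omega(e^t)$ is convex on $[0,+\infty)$. A general weight function satisfies all these properties except possibly $(\beta)$. The Young conjugate is $\varphi^*_\omega(s):=\sup_{t\ge 0}\{ts-\varphi_\omega(t)\}$, $s\ge 0$, and $W^{(\lambda)}_\alpha:=e^{\frac1\lambda\varphi^*_\omega(\lambda|\alpha|)}$ for $\lambda>0$, $\alpha\in\mathbb{N}_0^d$. $\mathcal{S}_{(\omega)}(\mathbb{R}^d)$ is the space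 of all $f\in C^\infty(\mathbb{R}^d)$ such that for every $\lambda>0$ one has $\sup_{\alpha,\beta\in\mathbb{N}_0^d}\|x^\alpha\partial^\beta f\|_\infty/W^{(\lambda)}_{\alpha+\beta}<\infty$, with the projective limit topology given by these seminorms ($\|\cdot\|_\infty$ is the supremum norm on $\mathbb{R}^d$). This is the definition by joint growth at infinity; in the definition by separated growth at infinity, $W^{(\lambda)}_{\alpha+\beta}$ is replaced by $W^{(\lambda)}_\alpha W^{(\lambda)}_\beta$. *)

theory Defs
  imports "HOL-Analysis.Analysis" "HOL-Library.Landau_Symbols"
begin

section \<open>Weight functions\<close>

text \<open>Weight functions live on \<open>[0,\<infinity>)\<close>; values at negative arguments are never used.\<close>

definition general_weight_function :: "(real \<Rightarrow> real) \<Rightarrow> bool" where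
  "general_weight_function \<omega> \<longleftrightarrow>
     continuous_on {0..} \<omega> \<and>
     mono_on {0..} \<omega> \<and>
     (\<forall>t\<ge>0. 0 \<le> \<omega> t) \<and>
     (\<exists>L\<ge>1. \<forall>t\<ge>0. \<omega> (2 * t) \<le> L * (\<omega> t + 1)) \<and>
     ln \<in> o[at_top](\<omega>) \<and>
     convex_on {0..} (\<lambda>t. \<omega> (exp t))"

definition weight_function :: "(real \<Rightarrow> real) \<Rightarrow> bool" where
  "weight_function \<omega> \<longleftrightarrow> general_weight_function \<omega> \<and> \<omega> \<in> O[at_top](\<lambda>t. t\<^sup>2)"

text \<open>For \<open>s \<ge> 0\<close> the set below is bounded above, since \<open>ln t = o(\<omega> t)\<close>; hence the
  supremum in the reals is the true one.\<close>

definition young_conj :: "(real \<Rightarrow> real) \<Rightarrow> real \<Rightarrow> real" where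
  "young_conj \<omega> s = (SUP t\<in>{0..}. t * s - \<omega> (exp t))"


section \<open>Multi-indices and smooth functions on \<open>\<real>\<^sup>d\<close>\<close>

text \<open>As the dimension \<open>d\<close> is quantified inside the statement, \<open>\<real>\<^sup>d\<close> is the library's
  \<^const>\<open>Euclidean_space\<close>: sequences vanishing at all indices \<open>i \<ge> d\<close>, with the product topology.
  Multi-indices are encoded in the same way.\<close>

definition multi_indices :: "nat \<Rightarrow> (nat \<Rightarrow> nat) set" where
  "multi_indices d = {\<alpha>. \<forall>i\<ge>d. \<alpha> i = 0}"

definition multi_abs :: "nat \<Rightarrow> (nat \<Rightarrow> nat) \<Rightarrow> nat" where
  "multi_abs d \<alpha> = (\<Sum>i<d. \<alpha> i)"

definition multi_power :: "nat \<Rightarrow> (nat \<Rightarrow> real) \<Rightarrow> (nat \<Rightarrow> nat) \<Rightarrow> real" where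
  "multi_power d x \<alpha> = (\<Prod>i<d. x i ^ \<alpha> i)"

definition partial_deriv :: "nat \<Rightarrow> ((nat \<Rightarrow> real) \<Rightarrow> complex) \<Rightarrow> (nat \<Rightarrow> real) \<Rightarrow> complex" where
  "partial_deriv i f x = vector_derivative (\<lambda>t. f (x(i := t))) (at (x i))"

definition iter_partial :: "nat list \<Rightarrow> ((nat \<Rightarrow> real) \<Rightarrow> complex) \<Rightarrow> (nat \<Rightarrow> real) \<Rightarrow> complex" where
  "iter_partial is f = foldr partial_deriv is f"

definition multi_deriv :: "nat \<Rightarrow> (nat \<Rightarrow> nat) \<Rightarrow> ((nat \<Rightarrow> real) \<Rightarrow> complex) \<Rightarrow> (nat \<Rightarrow> real) \<Rightarrow> complex" where
  "multi_deriv d \<beta> f = iter_partial (concat (map (\<lambda>i. replicate (\<beta> i) i) [0..<d])) f"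

text \<open>\<open>C\<^sup>\<infinity>\<close>: all iterated partial derivatives, in any order, exist and are continuous on \<open>\<real>\<^sup>d\<close>.\<close>

definition smooth_fun :: "nat \<Rightarrow> ((nat \<Rightarrow> real) \<Rightarrow> complex) \<Rightarrow> bool" where
  "smooth_fun d f \<longleftrightarrow> (\<forall>is. set is \<subseteq> {..<d} \<longrightarrow>
     continuous_map (Euclidean_space d) euclidean (iter_partial is f) \<and>
     (\<forall>x\<in>topspace (Euclidean_space d). \<forall>i<d.
        (\<lambda>t. iter_partial is f (x(i := t))) differentiable (at (x i))))"


section \<open>The global ultradifferentiable spaces of Beurling type\<close>

definition weight_seq :: "(real \<Rightarrow> real) \<Rightarrow> nat \<Rightarrow> real \<Rightarrow> (nat \<Rightarrow> nat) \<Rightarrow> real" where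
  "weight_seq \<omega> d \<mu> \<alpha> = exp (1 / \<mu> * young_conj \<omega> (\<mu> * real (multi_abs d \<alpha>)))"

datatype growth = Joint | Separated

fun growth_weight :: "growth \<Rightarrow> (real \<Rightarrow> real) \<Rightarrow> nat \<Rightarrow> real \<Rightarrow> (nat \<Rightarrow> nat) \<Rightarrow> (nat \<Rightarrow> nat) \<Rightarrow> real" where
  "growth_weight Joint \<omega> d \<mu> \<alpha> \<beta> = weight_seq \<omega> d \<mu> (\<lambda>i. \<alpha> i + \<beta> i)"
| "growth_weight Separated \<omega> d \<mu> \<alpha> \<beta> = weight_seq \<omega> d \<mu> \<alpha> * weight_seq \<omega> d \<mu> \<beta>"

definition sup_norm :: "nat \<Rightarrow> ((nat \<Rightarrow> real) \<Rightarrow> complex) \<Rightarrow> ennreal" where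
  "sup_norm d f = (SUP x\<in>topspace (Euclidean_space d). ennreal (norm (f x)))"

definition S_seminorm :: "growth \<Rightarrow> (real \<Rightarrow> real) \<Rightarrow> nat \<Rightarrow> real \<Rightarrow> ((nat \<Rightarrow> real) \<Rightarrow> complex) \<Rightarrow> ennreal" where
  "S_seminorm g \<omega> d \<mu> f =
     (SUP \<alpha>\<in>multi_indices d. SUP \<beta>\<in>multi_indices d.
        sup_norm d (\<lambda>x. complex_of_real (multi_power d x \<alpha>) * multi_deriv d \<beta> f x)
          / ennreal (growth_weight g \<omega> d \<mu> \<alpha> \<beta>))"

text \<open>A function on \<open>\<real>\<^sup>d\<close> is represented by its extension by zero to all sequences, so that
  distinct elements of the space are distinct functions on \<open>\<real>\<^sup>d\<close>.\<close>

definition S_space :: "growth \<Rightarrow> (real \<Rightarrow> real) \<Rightarrow> nat \<Rightarrow> ((nat \<Rightarrow> real) \<Rightarrow> complex) set" where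
  "S_space g \<omega> d =
     {f. (\<forall>x. x \<notin> topspace (Euclidean_space d) \<longrightarrow> f x = 0) \<and> smooth_fun d f \<and>
         (\<forall>\<mu>>0. S_seminorm g \<omega> d \<mu> f < \<infinity>)}"

text \<open>The projective limit topology: the open seminorm balls form a subbase.\<close>

definition S_topology :: "growth \<Rightarrow> (real \<Rightarrow> real) \<Rightarrow> nat \<Rightarrow> ((nat \<Rightarrow> real) \<Rightarrow> complex) topology" where
  "S_topology g \<omega> d = topology_generated_by
     {{h \<in> S_space g \<omega> d. S_seminorm g \<omega> d \<mu> (\<lambda>x. h x - f x) < ennreal \<epsilon>} | f \<mu> \<epsilon>.
        f \<in> S_space g \<omega> d \<and> \<mu> > 0 \<and> \<epsilon> > 0}"

definition continuous_inclusion :: "growth \<Rightarrow> (real \<Rightarrow> real) \<Rightarrow> (real \<Rightarrow> real) \<Rightarrow> nat \<Rightarrow> bool" where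
  "continuous_inclusion g \<omega> \<sigma> d \<longleftrightarrow>
     S_space g \<omega> d \<subseteq> S_space g \<sigma> d \<and>
     continuous_map (S_topology g \<omega> d) (S_topology g \<sigma> d) (\<lambda>f. f)"

end

theory Submission
  imports Defs "HOL-Complex_Analysis.Complex_Analysis"
begin

text \<open>
  If \<open>\<sigma> \<le> C\<omega> + D\<close>, then Young conjugation reverses the inequality: \<open>W\<^sub>\<omega>\<^bsup>(\<mu>/C)\<^esup>\<close> is at most a constant
  times \<open>W\<^sub>\<sigma>\<^bsup>(\<mu>)\<^esup>\<close> (\<open>weight_seq_domination\<close>). Every seminorm of the target space is therefore
  dominated by a seminorm of the source space, in any dimension and for either kind of growth, and
  the inclusion is continuous (\<open>continuous_inclusion_if_seminorms_dominated\<close>).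

  For the converse suppose \<open>\<sigma> = O(\<omega>)\<close> fails. Then there are points \<open>p\<^sub>n\<close> with \<open>\<sigma>(p\<^sub>n) \<ge> (n + 2)\<omega>(p\<^sub>n)\<close> and
  \<open>\<omega>(p\<^sub>n) \<ge> n\<close>, and the superposition of Gaussians
  \<open>f(x) = \<Sum>\<^sub>n e\<^bsup>-n\<omega>(p\<^sub>n)\<^esup> e\<^bsup>-(x - p\<^sub>n)\<^sup>2\<^esup>\<close>
  separates the two spaces in dimension one.

  It lies in the \<open>\<omega>\<close>-space. Since \<open>f\<close> is the restriction of an entire function, Cauchy's estimate
  bounds \<open>f\<^bsup>(k)\<^esup>(x)\<close> by \<open>k! e\<^bsup>r\<^sup>2\<^esup> r\<^bsup>-k\<^esup> H(x)\<close> with \<open>H(x) = \<Sum>\<^sub>n e\<^bsup>-n\<omega>(p\<^sub>n)\<^esup> e\<^bsup>-(x - p\<^sub>n)\<^sup>2/2\<^esup>\<close>. Because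
  \<open>\<omega>(t) = o(t\<^sup>2)\<close>, the first factor is \<open>O(W\<^sub>k)\<close> for every parameter when \<open>r = \<surd>k\<close>
  (\<open>Cauchy_factor_le_weight_seq\<close>), and the moments of \<open>H\<close> are \<open>O(W\<^sub>j)\<close> because the coefficients decay
  faster than every power of \<open>e\<^bsup>-\<omega>(2p\<^sub>n)\<^esup>\<close> (\<open>moments_gaussian_weights_le\<close>). The product
  \<open>W\<^sub>j W\<^sub>k\<close> is the separated weight, which is at most the joint one.

  It does not lie in the \<open>\<sigma>\<close>-space. There every function is \<open>O(x e\<^bsup>-\<sigma>(x)\<^esup>)\<close>, because a convex function
  is recovered from its conjugate (\<open>S_space_decay\<close>), whereas all summands of \<open>f\<close> are positive, so that
  \<open>f(p\<^sub>n) \<ge> e\<^bsup>-n\<omega>(p\<^sub>n)\<^esup>\<close>. Only derivatives of order zero enter here, so the kind of growth does not matter.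
\<close>


section \<open>Young conjugates and weight sequences\<close>

lemma general_weight_function_nonneg:
  "general_weight_function \<omega> \<Longrightarrow> 0 \<le> t \<Longrightarrow> 0 \<le> \<omega> t"
  by (simp add: general_weight_function_def)

lemma general_weight_function_mono:
  "general_weight_function \<omega> \<Longrightarrow> 0 \<le> s \<Longrightarrow> s \<le> t \<Longrightarrow> \<omega> s \<le> \<omega> t"
  by (auto simp: general_weight_function_def intro: mono_onD)

lemma young_conj_bdd_above:
  assumes \<omega>: "general_weight_function \<omega>" and s: "0 \<le> s"
  shows "bdd_above ((\<lambda>t. t * s - \<omega> (exp t)) ` {0..})"
proof -
  have "ln \<in> o[at_top](\<omega>)"
    using \<omega> by (simp add: general_weight_function_def)
  then have "eventually (\<lambda>x. norm (ln x) \<le> 1 / (s + 1) * norm (\<omega> x)) at_top"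
    using s by (intro landau_o.smallD) auto
  then obtain X where X: "\<And>x. X \<le> x \<Longrightarrow> \<bar>ln x\<bar> \<le> 1 / (s + 1) * \<bar>\<omega> x\<bar>"
    by (auto simp: eventually_at_top_linorder)
  show ?thesis
  proof (rule bdd_aboveI2)
    fix t :: real
    assume t: "t \<in> {0..}"
    show "t * s - \<omega> (exp t) \<le> s * \<bar>X\<bar>"
    proof (cases "X \<le> exp t")
      case True
      have "t \<le> 1 / (s + 1) * \<omega> (exp t)"
        using X[OF True] t general_weight_function_nonneg[OF \<omega>, of "exp t"] by simp
      then have "t * (s + 1) \<le> \<omega> (exp t)"
        using s by (simp add: field_simps)
      moreover have "0 \<le> s * \<bar>X\<bar>" "t * s \<le> t * (s + 1)"
        using s t by (auto simp: algebra_simps)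
      ultimately show ?thesis
        by linarith
    next
      case False
      then have "t \<le> \<bar>X\<bar>"
        using exp_ge_add_one_self[of t] by linarith
      then have "t * s \<le> s * \<bar>X\<bar>"
        using s by (simp add: mult.commute mult_left_mono)
      then show ?thesis
        using general_weight_function_nonneg[OF \<omega>, of "exp t"] by simp
    qed
  qed
qed

lemma young_conj_ge:
  assumes "general_weight_function \<omega>" "0 \<le> s" "0 \<le> t"
  shows "t * s - \<omega> (exp t) \<le> young_conj \<omega> s"
  unfolding young_conj_def
  using assms by (intro cSUP_upper young_conj_bdd_above) auto

lemma young_conj_le:
  assumes "\<And>t. 0 \<le> t \<Longrightarrow> t * s - \<omega> (exp t) \<le> B"
  shows "young_conj \<omega> s \<le> B"
  unfolding young_conj_def using assms by (intro cSUP_least) auto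

lemma young_conj_mono:
  assumes "general_weight_function \<omega>" "0 \<le> r" "r \<le> s"
  shows "young_conj \<omega> r \<le> young_conj \<omega> s"
proof (rule young_conj_le)
  fix t :: real
  assume t: "0 \<le> t"
  have "t * r \<le> t * s"
    using assms t by (simp add: mult_left_mono)
  then show "t * r - \<omega> (exp t) \<le> young_conj \<omega> s"
    using young_conj_ge[of \<omega> s t] assms t by linarith
qed

text \<open>Two competitors in the suprema on the left may both be moved to the larger of the two points, since
  \<open>\<omega>\<close> is nonnegative. This is what makes separated growth the stronger condition.\<close>

lemma young_conj_superadditive:
  assumes \<omega>: "general_weight_function \<omega>" and "0 \<le> r" "0 \<le> s"
  shows "young_conj \<omega> r + young_conj \<omega> s \<le> young_conj \<omega> (r + s)"
proof -
  have *: "(t * r - \<omega> (exp t)) + (u * s - \<omega> (exp u)) \<le> young_conj \<omega> (r + s)"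
    if "0 \<le> t" "0 \<le> u" for t u
  proof -
    let ?m = "max t u"
    have "t * r \<le> ?m * r" "u * s \<le> ?m * s"
      using assms by (auto intro: mult_right_mono)
    moreover have "\<omega> (exp ?m) \<le> \<omega> (exp t) + \<omega> (exp u)"
      using general_weight_function_nonneg[OF \<omega>, of "exp t"]
        general_weight_function_nonneg[OF \<omega>, of "exp u"] by (simp add: max_def)
    moreover have "?m * (r + s) - \<omega> (exp ?m) \<le> young_conj \<omega> (r + s)"
      using assms that by (intro young_conj_ge) auto
    ultimately show ?thesis
      by (simp add: algebra_simps)
  qed
  have "young_conj \<omega> s \<le> young_conj \<omega> (r + s) - (t * r - \<omega> (exp t))" if "0 \<le> t" for t
    using *[OF that] by (intro young_conj_le) (simp add: algebra_simps)
  then have "young_conj \<omega> r \<le> young_conj \<omega> (r + s) - young_conj \<omega> s"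
    by (intro young_conj_le) (simp add: algebra_simps)
  then show ?thesis
    by simp
qed

text \<open>Half of the Fenchel--Moreau identity for \<open>\<phi>(t) = \<omega>(e\<^sup>t)\<close>: the slope \<open>s\<close> of a supporting line
  of \<open>\<phi>\<close> at \<open>ln x\<close> attains the biconjugate. Only integral arguments occur in the weight
  sequence, and rounding \<open>s\<close> down costs at most the summand \<open>ln x\<close>.\<close>

lemma young_conj_biconjugate_nat:
  assumes \<omega>: "general_weight_function \<omega>" and x: "1 < x"
  obtains k :: nat where "\<omega> x - ln x \<le> real k * ln x - young_conj \<omega> (real k)"
proof -
  let ?\<phi> = "\<lambda>t. \<omega> (exp t)"
  let ?t = "ln x"
  have t: "0 < ?t"
    using x by simp
  define s where "s = Inf ((\<lambda>u. (?\<phi> ?t - ?\<phi> u) / (?t - u)) ` ({?t<..} \<inter> {0..}))"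
  have sub: "?\<phi> ?t + s * (u - ?t) \<le> ?\<phi> u" if "0 \<le> u" for u
    unfolding s_def using \<omega> t that
    by (intro convex_le_Inf_differential)
      (auto simp: general_weight_function_def interior_real_atLeast)
  have "?\<phi> 0 \<le> ?\<phi> ?t"
    using x by (intro general_weight_function_mono[OF \<omega>]) auto
  then have "0 \<le> s * ?t"
    using sub[of 0] by simp
  then have s: "0 \<le> s"
    using t by (simp add: zero_le_mult_iff)
  define k where "k = nat \<lfloor>s\<rfloor>"
  have k: "real k \<le> s" "s - 1 \<le> real k"
    using s unfolding k_def by linarith+
  have "young_conj \<omega> (real k) \<le> young_conj \<omega> s"
    using \<omega> k by (intro young_conj_mono) auto
  also have "\<dots> \<le> ?t * s - ?\<phi> ?t"
    using sub by (intro young_conj_le) (simp add: algebra_simps)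
  finally have "young_conj \<omega> (real k) \<le> ?t * s - \<omega> x"
    using x by simp
  moreover have "(s - 1) * ?t \<le> real k * ?t"
    using k t by (intro mult_right_mono) auto
  ultimately have "\<omega> x - ln x \<le> real k * ln x - young_conj \<omega> (real k)"
    by (simp add: algebra_simps)
  then show ?thesis
    by (rule that)
qed

text \<open>Every estimate that places a function in a space reduces to this lower bound on the weights, with
  \<open>R\<close> adapted to the order of a derivative or to the size of the point.\<close>

lemma power_le_weight_seq:
  assumes \<omega>: "general_weight_function \<omega>" and \<mu>: "0 < \<mu>" and R: "1 \<le> R"
  shows "R ^ multi_abs d \<alpha> \<le> exp (\<omega> R / \<mu>) * weight_seq \<omega> d \<mu> \<alpha>"
proof -
  let ?n = "real (multi_abs d \<alpha>)"
  have "ln R * (\<mu> * ?n) - \<omega> (exp (ln R)) \<le> young_conj \<omega> (\<mu> * ?n)"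
    using \<mu> R by (intro young_conj_ge[OF \<omega>]) auto
  then have "ln R * (\<mu> * ?n) / \<mu> \<le> (\<omega> R + young_conj \<omega> (\<mu> * ?n)) / \<mu>"
    using \<mu> R by (intro divide_right_mono) auto
  then have "?n * ln R \<le> \<omega> R / \<mu> + 1 / \<mu> * young_conj \<omega> (\<mu> * ?n)"
    using \<mu> by (simp add: add_divide_distrib mult_ac)
  then have "exp (?n * ln R) \<le> exp (\<omega> R / \<mu> + 1 / \<mu> * young_conj \<omega> (\<mu> * ?n))"
    by simp
  also have "exp (?n * ln R) = R ^ multi_abs d \<alpha>"
    using R by (simp add: exp_of_nat_mult)
  finally show ?thesis
    by (simp add: weight_seq_def exp_add)
qed

lemma weight_seq_pos: "0 < weight_seq \<omega> d \<mu> \<alpha>"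
  by (simp add: weight_seq_def)

lemma growth_weight_pos: "0 < growth_weight g \<omega> d \<mu> \<alpha> \<beta>"
  by (cases g) (auto simp: weight_seq_pos)

lemma weight_seq_product_le_growth_weight:
  assumes "general_weight_function \<omega>" "0 < \<mu>"
  shows "weight_seq \<omega> d \<mu> \<alpha> * weight_seq \<omega> d \<mu> \<beta> \<le> growth_weight g \<omega> d \<mu> \<alpha> \<beta>"
proof (cases g)
  case Joint
  have "young_conj \<omega> (\<mu> * real (multi_abs d \<alpha>)) + young_conj \<omega> (\<mu> * real (multi_abs d \<beta>))
      \<le> young_conj \<omega> (\<mu> * real (multi_abs d (\<lambda>i. \<alpha> i + \<beta> i)))"
    using young_conj_superadditive[OF assms(1), of "\<mu> * real (multi_abs d \<alpha>)"
        "\<mu> * real (multi_abs d \<beta>)"] less_imp_le[OF assms(2)]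
    by (simp add: multi_abs_def sum.distrib distrib_left sum_nonneg)
  then show ?thesis
    using Joint assms(2)
    by (simp add: weight_seq_def exp_add[symmetric] add_divide_distrib[symmetric]
        divide_right_mono)
qed simp

lemma growth_weight_zero_le:
  assumes \<omega>: "general_weight_function \<omega>" and \<mu>: "0 < \<mu>"
  shows "growth_weight g \<omega> d \<mu> \<alpha> (\<lambda>i. 0) \<le> weight_seq \<omega> d \<mu> \<alpha>"
proof -
  have "young_conj \<omega> 0 \<le> 0"
    using general_weight_function_nonneg[OF \<omega>] by (intro young_conj_le) simp
  then have "weight_seq \<omega> d \<mu> (\<lambda>i. 0) \<le> 1"
    using \<mu> by (simp add: weight_seq_def multi_abs_def divide_nonpos_pos)
  then show ?thesis
    using weight_seq_pos[of \<omega> d \<mu> \<alpha>] by (cases g) (auto simp: mult_left_le)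
qed


section \<open>The seminorms and the projective limit topology\<close>

text \<open>The seminorms are suprema of quotients in the extended nonnegative reals; all later estimates
  are pointwise bounds between real numbers.\<close>

lemma S_seminorm_le_iff:
  assumes "0 \<le> M"
  shows "S_seminorm g \<omega> d \<mu> f \<le> ennreal M \<longleftrightarrow>
    (\<forall>\<alpha>\<in>multi_indices d. \<forall>\<beta>\<in>multi_indices d. \<forall>x\<in>topspace (Euclidean_space d).
       \<bar>multi_power d x \<alpha>\<bar> * norm (multi_deriv d \<beta> f x) \<le> M * growth_weight g \<omega> d \<mu> \<alpha> \<beta>)"
proof -
  have *: "z / ennreal w \<le> ennreal M \<longleftrightarrow> z \<le> ennreal (M * w)" if "0 < w" for z :: ennreal and w
    using that assms
    by (cases z) (auto simp: divide_ennreal pos_divide_le_eq ennreal_top_divide top_unique)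
  show ?thesis
    unfolding S_seminorm_def SUP_le_iff
    using assms growth_weight_pos[of g \<omega> d \<mu>]
    by (simp add: * sup_norm_def SUP_le_iff norm_mult less_imp_le)
qed

lemma iter_partial_diff:
  assumes f: "smooth_fun d f" and h: "smooth_fun d h"
    and "set js \<subseteq> {..<d}" "x \<in> topspace (Euclidean_space d)"
  shows "iter_partial js (\<lambda>x. f x - h x) x = iter_partial js f x - iter_partial js h x"
  using assms(3,4)
proof (induction js arbitrary: x)
  case Nil
  then show ?case
    by (simp add: iter_partial_def)
next
  case (Cons j js)
  have js: "set js \<subseteq> {..<d}" and j: "j < d"
    using Cons.prems by auto
  have top: "x(j := t) \<in> topspace (Euclidean_space d)" for t
    using Cons.prems j by (auto simp: topspace_Euclidean_space)
  have diff: "(\<lambda>t. iter_partial js f (x(j := t))) differentiable (at (x j))"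
    "(\<lambda>t. iter_partial js h (x(j := t))) differentiable (at (x j))"
    using f h js j Cons.prems unfolding smooth_fun_def by blast+
  have "iter_partial (j # js) (\<lambda>x. f x - h x) x =
      vector_derivative (\<lambda>t. iter_partial js f (x(j := t)) - iter_partial js h (x(j := t)))
        (at (x j))"
    using Cons.IH[OF js top] by (simp add: iter_partial_def partial_deriv_def del: fun_upd_apply)
  also have "\<dots> = iter_partial (j # js) f x - iter_partial (j # js) h x"
    using vector_derivative_diff_at[OF diff] by (simp add: iter_partial_def partial_deriv_def)
  finally show ?case .
qed

lemma multi_deriv_diff:
  assumes "smooth_fun d f" "smooth_fun d h" "x \<in> topspace (Euclidean_space d)"
  shows "multi_deriv d \<beta> (\<lambda>x. f x - h x) x = multi_deriv d \<beta> f x - multi_deriv d \<beta> h x"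
  unfolding multi_deriv_def using assms by (intro iter_partial_diff) auto

lemma S_seminorm_triangle:
  assumes "smooth_fun d f" "smooth_fun d g" "smooth_fun d h" "0 \<le> M" "0 \<le> N"
    and "S_seminorm gr \<omega> d \<mu> (\<lambda>x. f x - g x) \<le> ennreal M"
    and "S_seminorm gr \<omega> d \<mu> (\<lambda>x. g x - h x) \<le> ennreal N"
  shows "S_seminorm gr \<omega> d \<mu> (\<lambda>x. f x - h x) \<le> ennreal (M + N)"
  unfolding S_seminorm_le_iff[OF add_nonneg_nonneg[OF assms(4,5)]]
proof (intro ballI)
  fix \<alpha> \<beta> x
  assume \<alpha>: "\<alpha> \<in> multi_indices d" and \<beta>: "\<beta> \<in> multi_indices d"
    and x: "x \<in> topspace (Euclidean_space d)"
  let ?p = "\<bar>multi_power d x \<alpha>\<bar>" and ?D = "\<lambda>f. multi_deriv d \<beta> f x"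
    and ?W = "growth_weight gr \<omega> d \<mu> \<alpha> \<beta>"
  have "?p * norm (?D (\<lambda>x. f x - h x)) = ?p * norm ((?D f - ?D g) + (?D g - ?D h))"
    using multi_deriv_diff[OF assms(1,3) x] by simp
  also have "\<dots> \<le> ?p * (norm (?D f - ?D g) + norm (?D g - ?D h))"
    by (intro mult_left_mono norm_triangle_ineq) auto
  also have "\<dots> = ?p * norm (?D (\<lambda>x. f x - g x)) + ?p * norm (?D (\<lambda>x. g x - h x))"
    using multi_deriv_diff[OF assms(1,2) x] multi_deriv_diff[OF assms(2,3) x]
    by (simp add: distrib_left)
  also have "\<dots> \<le> M * ?W + N * ?W"
    using assms(4-7) \<alpha> \<beta> x by (intro add_mono) (simp_all add: S_seminorm_le_iff)
  finally show "?p * norm (?D (\<lambda>x. f x - h x)) \<le> (M + N) * ?W"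
    by (simp add: distrib_right)
qed

lemma S_seminorm_diff_self:
  assumes "smooth_fun d f"
  shows "S_seminorm g \<omega> d \<mu> (\<lambda>x. f x - f x) = 0"
proof -
  have "S_seminorm g \<omega> d \<mu> (\<lambda>x. f x - f x) \<le> ennreal 0"
    unfolding S_seminorm_le_iff[OF order_refl] using multi_deriv_diff[OF assms assms] by simp
  then show ?thesis
    by simp
qed

lemma topspace_S_topology: "topspace (S_topology g \<omega> d) = S_space g \<omega> d"
proof -
  let ?ball = "\<lambda>f \<mu> \<epsilon>. {h \<in> S_space g \<omega> d. S_seminorm g \<omega> d \<mu> (\<lambda>x. h x - f x) < ennreal \<epsilon>}"
  have "f \<in> topspace (S_topology g \<omega> d)" if f: "f \<in> S_space g \<omega> d" for f
  proof -
    have "openin (S_topology g \<omega> d) (?ball f 1 1)"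
      unfolding S_topology_def using f
      by (intro topology_generated_by_Basis CollectI exI[of _ f] exI[of _ 1]) simp
    moreover have "f \<in> ?ball f 1 1"
      using f S_seminorm_diff_self[of d f g \<omega> 1] by (simp add: S_space_def)
    ultimately show ?thesis
      by (blast dest: openin_subset)
  qed
  moreover have "topspace (S_topology g \<omega> d) \<subseteq> S_space g \<omega> d"
    unfolding S_topology_def topology_generated_by_topspace by blast
  ultimately show ?thesis
    by blast
qed

text \<open>The preimage of a seminorm ball of the coarser system is open because around each of its points
  there is room for a ball of the finer one; that point need not be the centre, and the centre need
  not lie in the smaller space.\<close>

lemma continuous_inclusion_if_seminorms_dominated:
  assumes dom: "\<And>\<mu>. 0 < \<mu> \<Longrightarrow> \<exists>\<nu>>0. \<exists>K>0. \<forall>f. \<forall>M\<ge>0.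
      S_seminorm g \<omega> d \<nu> f \<le> ennreal M \<longrightarrow> S_seminorm g \<sigma> d \<mu> f \<le> ennreal (K * M)"
  shows "continuous_inclusion g \<omega> \<sigma> d"
proof -
  have sub: "S_space g \<omega> d \<subseteq> S_space g \<sigma> d"
  proof
    fix f
    assume f: "f \<in> S_space g \<omega> d"
    have "S_seminorm g \<sigma> d \<mu> f < \<infinity>" if \<mu>: "0 < \<mu>" for \<mu>
    proof -
      obtain \<nu> K where \<nu>: "0 < \<nu>" and K: "\<And>M. 0 \<le> M \<Longrightarrow> S_seminorm g \<omega> d \<nu> f \<le> ennreal M \<Longrightarrow>
          S_seminorm g \<sigma> d \<mu> f \<le> ennreal (K * M)"
        using dom[OF \<mu>] by blast
      have "S_seminorm g \<omega> d \<nu> f < \<infinity>"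
        using f \<nu> by (simp add: S_space_def)
      then obtain M where "0 \<le> M" "S_seminorm g \<omega> d \<nu> f = ennreal M"
        by (cases "S_seminorm g \<omega> d \<nu> f") auto
      then show ?thesis
        using K[of M] by (simp add: le_less_trans)
    qed
    then show "f \<in> S_space g \<sigma> d"
      using f by (simp add: S_space_def)
  qed
  have "continuous_map (S_topology g \<omega> d) (S_topology g \<sigma> d) (\<lambda>f. f)"
    unfolding S_topology_def[of g \<sigma> d]
  proof (rule continuous_on_generated_topo)
    fix U
    assume "U \<in> {{h \<in> S_space g \<sigma> d. S_seminorm g \<sigma> d \<mu> (\<lambda>x. h x - f x) < ennreal \<epsilon>} | f \<mu> \<epsilon>.
        f \<in> S_space g \<sigma> d \<and> \<mu> > 0 \<and> \<epsilon> > 0}"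
    then obtain f \<mu> \<epsilon> where f: "f \<in> S_space g \<sigma> d" and \<mu>: "0 < \<mu>" and "0 < \<epsilon>"
      and U: "U = {h \<in> S_space g \<sigma> d. S_seminorm g \<sigma> d \<mu> (\<lambda>x. h x - f x) < ennreal \<epsilon>}"
      by blast
    obtain \<nu> K where \<nu>: "0 < \<nu>" and K: "0 < K" "\<And>f M. 0 \<le> M \<Longrightarrow>
        S_seminorm g \<omega> d \<nu> f \<le> ennreal M \<Longrightarrow> S_seminorm g \<sigma> d \<mu> f \<le> ennreal (K * M)"
      using dom[OF \<mu>] by blast
    show "openin (S_topology g \<omega> d) ((\<lambda>f. f) -` U \<inter> topspace (S_topology g \<omega> d))"
      unfolding topspace_S_topology
    proof (subst openin_subopen, intro ballI)
      fix k
      assume "k \<in> (\<lambda>f. f) -` U \<inter> S_space g \<omega> d"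
      then have k: "k \<in> S_space g \<omega> d" and k_less: "S_seminorm g \<sigma> d \<mu> (\<lambda>x. k x - f x) < ennreal \<epsilon>"
        by (auto simp: U)
      obtain N where N: "0 \<le> N" "S_seminorm g \<sigma> d \<mu> (\<lambda>x. k x - f x) = ennreal N"
        using k_less by (cases "S_seminorm g \<sigma> d \<mu> (\<lambda>x. k x - f x)") auto
      have "N < \<epsilon>"
        using k_less N \<open>0 < \<epsilon>\<close> by (simp add: ennreal_less_iff)
      define \<delta> where "\<delta> = (\<epsilon> - N) / (2 * K)"
      have \<delta>: "0 < \<delta>" "K * \<delta> + N < \<epsilon>"
        using \<open>N < \<epsilon>\<close> K(1) by (auto simp: \<delta>_def field_simps)
      let ?T = "{h \<in> S_space g \<omega> d. S_seminorm g \<omega> d \<nu> (\<lambda>x. h x - k x) < ennreal \<delta>}"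
      have "openin (S_topology g \<omega> d) ?T"
        unfolding S_topology_def using k \<nu> \<delta> by (intro topology_generated_by_Basis) blast
      moreover have "k \<in> ?T"
        using k \<delta> S_seminorm_diff_self[of d k g \<omega> \<nu>] by (simp add: S_space_def)
      moreover have "?T \<subseteq> (\<lambda>f. f) -` U \<inter> S_space g \<omega> d"
      proof
        fix h
        assume h: "h \<in> ?T"
        then have h_mem: "h \<in> S_space g \<sigma> d"
          using sub by auto
        have "S_seminorm g \<sigma> d \<mu> (\<lambda>x. h x - k x) \<le> ennreal (K * \<delta>)"
          using h \<delta> by (intro K(2)) auto
        then have "S_seminorm g \<sigma> d \<mu> (\<lambda>x. h x - f x) \<le> ennreal (K * \<delta> + N)"
          using h_mem f k sub K(1) \<delta> N
          by (intro S_seminorm_triangle[of d h k f]) (auto simp: S_space_def)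
        also have "\<dots> < ennreal \<epsilon>"
          using \<delta> \<open>0 < \<epsilon>\<close> by (intro ennreal_lessI) auto
        finally show "h \<in> (\<lambda>f. f) -` U \<inter> S_space g \<omega> d"
          using h h_mem by (simp add: U)
      qed
      ultimately show "\<exists>T. openin (S_topology g \<omega> d) T \<and> k \<in> T \<and>
          T \<subseteq> (\<lambda>f. f) -` U \<inter> S_space g \<omega> d"
        by blast
    qed
  next
    have "(\<lambda>f. f) ` topspace (S_topology g \<omega> d) \<subseteq> topspace (S_topology g \<sigma> d)"
      using sub by (simp add: topspace_S_topology)
    then show "(\<lambda>f. f) ` topspace (S_topology g \<omega> d) \<subseteq>
        \<Union> {{h \<in> S_space g \<sigma> d. S_seminorm g \<sigma> d \<mu> (\<lambda>x. h x - f x) < ennreal \<epsilon>} | f \<mu> \<epsilon>.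
          f \<in> S_space g \<sigma> d \<and> \<mu> > 0 \<and> \<epsilon> > 0}"
      unfolding S_topology_def[of g \<sigma> d] topology_generated_by_topspace .
  qed
  then show ?thesis
    using sub by (simp add: continuous_inclusion_def)
qed


section \<open>Domination of the weights gives continuous inclusion\<close>

lemma bigo_weight_affine_bound:
  assumes \<omega>: "general_weight_function \<omega>" and \<sigma>: "general_weight_function \<sigma>"
    and "\<sigma> \<in> O[at_top](\<omega>)"
  obtains C D where "0 < C" "0 \<le> D" "\<And>x. 0 \<le> x \<Longrightarrow> \<sigma> x \<le> C * \<omega> x + D"
proof -
  obtain C where C: "0 < C" "eventually (\<lambda>x. norm (\<sigma> x) \<le> C * norm (\<omega> x)) at_top"
    using assms(3) by (elim landau_o.bigE)
  then obtain X where X: "\<And>x. X \<le> x \<Longrightarrow> \<bar>\<sigma> x\<bar> \<le> C * \<bar>\<omega> x\<bar>"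
    by (auto simp: eventually_at_top_linorder)
  have "\<sigma> x \<le> C * \<omega> x + \<sigma> \<bar>X\<bar>" if x: "0 \<le> x" for x
  proof (cases "X \<le> x")
    case True
    then show ?thesis
      using X[OF True] general_weight_function_nonneg[OF \<omega> x]
        general_weight_function_nonneg[OF \<sigma>, of "\<bar>X\<bar>"] by simp
  next
    case False
    then have "\<sigma> x \<le> \<sigma> \<bar>X\<bar>"
      using x by (intro general_weight_function_mono[OF \<sigma>]) auto
    then show ?thesis
      using general_weight_function_nonneg[OF \<omega> x] C(1) by (simp add: add_increasing)
  qed
  then show ?thesis
    using that C(1) general_weight_function_nonneg[OF \<sigma>, of "\<bar>X\<bar>"] by simp
qed

text \<open>Conjugation reverses \<open>\<phi>\<^sub>\<sigma> \<le> C \<phi>\<^sub>\<omega> + D\<close> and turns the factor \<open>C\<close> into a dilation, which the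
  change of parameter from \<open>\<mu>\<close> to \<open>\<mu> / C\<close> absorbs.\<close>

lemma weight_seq_domination:
  assumes \<sigma>: "general_weight_function \<sigma>" and C: "0 < C"
    and le: "\<And>x. 0 \<le> x \<Longrightarrow> \<sigma> x \<le> C * \<omega> x + D" and \<mu>: "0 < \<mu>"
  shows "weight_seq \<omega> d (\<mu> / C) \<alpha> \<le> exp (D / \<mu>) * weight_seq \<sigma> d \<mu> \<alpha>"
proof -
  define s where "s = \<mu> * real (multi_abs d \<alpha>)"
  have s: "0 \<le> s"
    using \<mu> by (simp add: s_def)
  have "young_conj \<omega> (s / C) \<le> (young_conj \<sigma> s + D) / C"
  proof (rule young_conj_le)
    fix t :: real
    assume t: "0 \<le> t"
    have "t * s - C * \<omega> (exp t) \<le> young_conj \<sigma> s + D"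
      using young_conj_ge[OF \<sigma> s t] le[of "exp t"] by simp
    then have "(t * s - C * \<omega> (exp t)) / C \<le> (young_conj \<sigma> s + D) / C"
      using C by (intro divide_right_mono) auto
    then show "t * (s / C) - \<omega> (exp t) \<le> (young_conj \<sigma> s + D) / C"
      using C by (simp add: diff_divide_distrib)
  qed
  then have "C / \<mu> * young_conj \<omega> (s / C) \<le> C / \<mu> * ((young_conj \<sigma> s + D) / C)"
    using C \<mu> by (intro mult_left_mono) auto
  also have "\<dots> = D / \<mu> + 1 / \<mu> * young_conj \<sigma> s"
    using C \<mu> by (simp add: field_simps)
  finally have "exp (C / \<mu> * young_conj \<omega> (s / C)) \<le> exp (D / \<mu> + 1 / \<mu> * young_conj \<sigma> s)"
    by simp
  then show ?thesis
    by (simp add: weight_seq_def s_def exp_add)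
qed

lemma growth_weight_domination:
  assumes \<sigma>: "general_weight_function \<sigma>" and C: "0 < C" and D: "0 \<le> D"
    and le: "\<And>x. 0 \<le> x \<Longrightarrow> \<sigma> x \<le> C * \<omega> x + D" and \<mu>: "0 < \<mu>"
  shows "growth_weight g \<omega> d (\<mu> / C) \<alpha> \<beta> \<le> (exp (D / \<mu>))\<^sup>2 * growth_weight g \<sigma> d \<mu> \<alpha> \<beta>"
proof (cases g)
  case Joint
  have "1 \<le> exp (D / \<mu>)"
    using D \<mu> by simp
  then have "exp (D / \<mu>) \<le> (exp (D / \<mu>))\<^sup>2"
    by (rule self_le_power) simp
  then have "exp (D / \<mu>) * weight_seq \<sigma> d \<mu> (\<lambda>i. \<alpha> i + \<beta> i) \<le>
      (exp (D / \<mu>))\<^sup>2 * weight_seq \<sigma> d \<mu> (\<lambda>i. \<alpha> i + \<beta> i)"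
    using weight_seq_pos by (intro mult_right_mono) (auto intro: less_imp_le)
  with weight_seq_domination[OF \<sigma> C le \<mu>] show ?thesis
    unfolding Joint growth_weight.simps by (rule order_trans)
next
  case Separated
  have "weight_seq \<omega> d (\<mu> / C) \<alpha> * weight_seq \<omega> d (\<mu> / C) \<beta> \<le>
      (exp (D / \<mu>) * weight_seq \<sigma> d \<mu> \<alpha>) * (exp (D / \<mu>) * weight_seq \<sigma> d \<mu> \<beta>)"
    using weight_seq_pos
    by (intro mult_mono weight_seq_domination[OF \<sigma> C le \<mu>]) (auto intro: less_imp_le)
  then show ?thesis
    by (simp add: Separated power2_eq_square mult_ac)
qed

lemma continuous_inclusion_if_bigo:
  assumes \<omega>: "general_weight_function \<omega>" and \<sigma>: "general_weight_function \<sigma>"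
    and "\<sigma> \<in> O[at_top](\<omega>)"
  shows "continuous_inclusion g \<omega> \<sigma> d"
proof (rule continuous_inclusion_if_seminorms_dominated)
  fix \<mu> :: real
  assume \<mu>: "0 < \<mu>"
  obtain C D where C: "0 < C" and D: "0 \<le> D" and le: "\<And>x. 0 \<le> x \<Longrightarrow> \<sigma> x \<le> C * \<omega> x + D"
    using bigo_weight_affine_bound[OF assms] by metis
  let ?K = "(exp (D / \<mu>))\<^sup>2"
  have "S_seminorm g \<sigma> d \<mu> f \<le> ennreal (?K * M)"
    if M: "0 \<le> M" and bound: "S_seminorm g \<omega> d (\<mu> / C) f \<le> ennreal M" for f M
  proof -
    have KM: "0 \<le> ?K * M"
      using M by simp
    show ?thesis
      unfolding S_seminorm_le_iff[OF KM]
    proof (intro ballI)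
      fix \<alpha> \<beta> x
      assume "\<alpha> \<in> multi_indices d" "\<beta> \<in> multi_indices d" "x \<in> topspace (Euclidean_space d)"
      then have "\<bar>multi_power d x \<alpha>\<bar> * norm (multi_deriv d \<beta> f x) \<le>
          M * growth_weight g \<omega> d (\<mu> / C) \<alpha> \<beta>"
        using bound M by (simp add: S_seminorm_le_iff)
      also have "\<dots> \<le> M * (?K * growth_weight g \<sigma> d \<mu> \<alpha> \<beta>)"
        using M by (intro mult_left_mono growth_weight_domination[OF \<sigma> C D le \<mu>])
      finally show "\<bar>multi_power d x \<alpha>\<bar> * norm (multi_deriv d \<beta> f x) \<le>
          ?K * M * growth_weight g \<sigma> d \<mu> \<alpha> \<beta>"
        by (simp add: mult_ac)
    qed
  qed
  then show "\<exists>\<nu>>0. \<exists>K>0. \<forall>f. \<forall>M\<ge>0.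
      S_seminorm g \<omega> d \<nu> f \<le> ennreal M \<longrightarrow> S_seminorm g \<sigma> d \<mu> f \<le> ennreal (K * M)"
    using C \<mu> by (intro exI[of _ "\<mu> / C"] conjI exI[of _ ?K]) auto
qed


section \<open>Entire functions as smooth functions of one real variable\<close>

definition restrict_to_line :: "(complex \<Rightarrow> complex) \<Rightarrow> (nat \<Rightarrow> real) \<Rightarrow> complex" where
  "restrict_to_line F x =
    (if x \<in> topspace (Euclidean_space 1) then F (complex_of_real (x 0)) else 0)"

lemma restrict_to_line_update:
  "restrict_to_line F (x(0 := t)) =
    (if x \<in> topspace (Euclidean_space 1) then F (complex_of_real t) else 0)"
  by (auto simp: restrict_to_line_def topspace_Euclidean_space)

lemma restrict_to_line_has_vector_derivative:
  assumes "F holomorphic_on UNIV"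
  shows "((\<lambda>t. restrict_to_line F (x(0 := t))) has_vector_derivative
    restrict_to_line (deriv F) x) (at (x 0))"
proof (cases "x \<in> topspace (Euclidean_space 1)")
  case True
  have "(F has_field_derivative deriv F (complex_of_real (x 0))) (at (complex_of_real (x 0)))"
    using assms by (intro holomorphic_derivI[of F UNIV]) auto
  then show ?thesis
    unfolding restrict_to_line_update
    using True by (simp add: restrict_to_line_def has_vector_derivative_real_field)
next
  case False
  then show ?thesis
    unfolding restrict_to_line_update by (simp add: restrict_to_line_def)
qed

lemma iter_partial_restrict_to_line:
  assumes F: "F holomorphic_on UNIV" and "set js \<subseteq> {..<1}"
  shows "iter_partial js (restrict_to_line F) = restrict_to_line ((deriv ^^ length js) F)"
  using assms(2)
proof (induction js)
  case Nil
  then show ?case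
    by (simp add: iter_partial_def)
next
  case (Cons j js)
  let ?G = "(deriv ^^ length js) F"
  have "?G holomorphic_on UNIV"
    using F by (intro holomorphic_higher_deriv) auto
  then have "partial_deriv 0 (restrict_to_line ?G) = restrict_to_line (deriv ?G)"
    by (intro ext) (simp add: partial_deriv_def vector_derivative_at
        restrict_to_line_has_vector_derivative)
  then show ?case
    using Cons by (simp add: iter_partial_def)
qed

lemma multi_deriv_restrict_to_line:
  assumes "F holomorphic_on UNIV"
  shows "multi_deriv 1 \<beta> (restrict_to_line F) = restrict_to_line ((deriv ^^ \<beta> 0) F)"
proof -
  have "set (replicate (\<beta> 0) 0) \<subseteq> {..<1::nat}"
    by auto
  then show ?thesis
    using iter_partial_restrict_to_line[OF assms, of "replicate (\<beta> 0) 0"]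
    by (simp add: multi_deriv_def)
qed

lemma smooth_fun_restrict_to_line:
  assumes F: "F holomorphic_on UNIV"
  shows "smooth_fun 1 (restrict_to_line F)"
  unfolding smooth_fun_def
proof (intro allI impI conjI ballI)
  fix js :: "nat list"
  assume js: "set js \<subseteq> {..<1}"
  define G where "G = (deriv ^^ length js) F"
  have G: "G holomorphic_on UNIV"
    unfolding G_def using F by (intro holomorphic_higher_deriv) auto
  have iter: "iter_partial js (restrict_to_line F) = restrict_to_line G"
    unfolding G_def using F js by (rule iter_partial_restrict_to_line)
  have "continuous_map euclideanreal euclidean (\<lambda>t. G (complex_of_real t))"
    using holomorphic_on_imp_continuous_on[OF G]
    by (auto intro!: continuous_on_compose2[of UNIV G] continuous_intros)
  moreover have "continuous_map (Euclidean_space 1) euclideanreal (\<lambda>x. x 0)"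
    unfolding Euclidean_space_def
    by (intro continuous_map_from_subtopology continuous_map_product_projection) auto
  ultimately have "continuous_map (Euclidean_space 1) euclidean
      ((\<lambda>t. G (complex_of_real t)) \<circ> (\<lambda>x. x 0))"
    by (metis continuous_map_compose)
  then show "continuous_map (Euclidean_space 1) euclidean (iter_partial js (restrict_to_line F))"
    unfolding iter by (rule continuous_map_eq) (simp add: restrict_to_line_def)
  fix x :: "nat \<Rightarrow> real" and i :: nat
  assume "i < 1"
  then show "(\<lambda>t. iter_partial js (restrict_to_line F) (x(i := t))) differentiable (at (x i))"
    unfolding iter using restrict_to_line_has_vector_derivative[OF G, of x]
    by (auto intro: differentiableI_vector)
qed


section \<open>Superpositions of translated Gaussians\<close>

definition gaussian_superposition :: "(nat \<Rightarrow> real) \<Rightarrow> (nat \<Rightarrow> real) \<Rightarrow> complex \<Rightarrow> complex" where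
  "gaussian_superposition a p z =
    (\<Sum>n. complex_of_real (a n) * exp (- (z - complex_of_real (p n))\<^sup>2))"

lemma norm_gaussian_le:
  fixes z :: complex
  assumes "norm (z - complex_of_real x) \<le> r"
  shows "norm (exp (- (z - complex_of_real p)\<^sup>2)) \<le> exp (r\<^sup>2) * exp (- (x - p)\<^sup>2 / 2)"
proof -
  have "(Re z - x)\<^sup>2 + (Im z)\<^sup>2 \<le> r\<^sup>2"
    using power_mono[OF assms, of 2] by (simp add: cmod_power2)
  moreover have "0 \<le> ((x - p) + 2 * (Re z - x))\<^sup>2 / 2"
    by simp
  moreover have "((x - p) + 2 * (Re z - x))\<^sup>2 / 2 =
      (Re z - p)\<^sup>2 + (Re z - x)\<^sup>2 - (x - p)\<^sup>2 / 2"
    by (simp add: power2_eq_square field_simps)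
  ultimately have "(Im z)\<^sup>2 - (Re z - p)\<^sup>2 \<le> r\<^sup>2 + - (x - p)\<^sup>2 / 2"
    by linarith
  moreover have "Re (- (z - complex_of_real p)\<^sup>2) = (Im z)\<^sup>2 - (Re z - p)\<^sup>2"
    by (simp add: power2_eq_square)
  ultimately have "Re (- (z - complex_of_real p)\<^sup>2) \<le> r\<^sup>2 + - (x - p)\<^sup>2 / 2"
    by simp
  then show ?thesis
    unfolding norm_exp_eq_Re exp_add[symmetric] exp_le_cancel_iff .
qed

lemma gaussian_superposition_term_le:
  assumes "0 \<le> a" "norm (z - complex_of_real x) \<le> r"
  shows "norm (complex_of_real a * exp (- (z - complex_of_real p)\<^sup>2)) \<le>
    exp (r\<^sup>2) * (a * exp (- (x - p)\<^sup>2 / 2))"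
  using mult_left_mono[OF norm_gaussian_le[OF assms(2)] assms(1), of p] assms(1)
  by (simp add: norm_mult mult_ac)

lemma summable_times_exp_nonpos:
  fixes a e :: "nat \<Rightarrow> real"
  assumes "\<And>n. 0 \<le> a n" "summable a" "\<And>n. e n \<le> 0"
  shows "summable (\<lambda>n. a n * exp (e n))"
  using assms
  by (intro summable_comparison_test'[OF assms(2), of 0]) (simp add: abs_mult mult_left_le)

lemma holomorphic_gaussian_superposition:
  assumes a: "\<And>n. 0 \<le> a n" "summable a"
  shows "gaussian_superposition a p holomorphic_on UNIV"
proof (rule holomorphic_uniform_sequence)
  let ?f = "\<lambda>n z. complex_of_real (a n) * exp (- (z - complex_of_real (p n))\<^sup>2)"
  show "(\<lambda>z. \<Sum>i<n. ?f i z) holomorphic_on UNIV" for n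
    by (intro holomorphic_intros)
  fix z :: complex
  have "norm (?f n w) \<le> exp ((norm z + 1)\<^sup>2) * a n" if w: "w \<in> cball z 1" for n w
  proof -
    have "norm (w - complex_of_real 0) \<le> norm z + 1"
      using w norm_triangle_ineq2[of w z] by (simp add: dist_norm norm_minus_commute)
    then have "norm (?f n w) \<le> exp ((norm z + 1)\<^sup>2) * (a n * exp (- (0 - p n)\<^sup>2 / 2))"
      by (intro gaussian_superposition_term_le a)
    also have "\<dots> \<le> exp ((norm z + 1)\<^sup>2) * a n"
      using a by (intro mult_left_mono) (auto simp: mult_left_le)
    finally show ?thesis .
  qed
  then have "uniform_limit (cball z 1) (\<lambda>n w. \<Sum>i<n. ?f i w) (gaussian_superposition a p)
      sequentially"
    unfolding gaussian_superposition_def[abs_def]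
    using a by (intro Weierstrass_m_test[where M = "\<lambda>n. exp ((norm z + 1)\<^sup>2) * a n"]
        summable_mult) auto
  then show "\<exists>d>0. cball z d \<subseteq> UNIV \<and>
      uniform_limit (cball z d) (\<lambda>n w. \<Sum>i<n. ?f i w) (gaussian_superposition a p) sequentially"
    by (intro exI[of _ 1]) simp
qed simp

text \<open>Cauchy's estimate on the circle of radius \<open>r\<close>: leaving the real axis by at most \<open>r\<close> costs the factor
  \<open>e\<^bsup>r\<^sup>2\<^esup>\<close> and half of the Gaussian decay. The radius remains free and will be adapted to \<open>k\<close>.\<close>

lemma higher_deriv_gaussian_superposition_le:
  assumes a: "\<And>n. 0 \<le> a n" "summable a" and r: "0 < r"
  shows "norm ((deriv ^^ k) (gaussian_superposition a p) (complex_of_real x)) \<le>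
    fact k * exp (r\<^sup>2) / r ^ k * (\<Sum>n. a n * exp (- (x - p n)\<^sup>2 / 2))"
proof -
  let ?F = "gaussian_superposition a p" and ?H = "\<Sum>n. a n * exp (- (x - p n)\<^sup>2 / 2)"
  have hol: "?F holomorphic_on UNIV"
    using a by (rule holomorphic_gaussian_superposition)
  have sum: "summable (\<lambda>n. a n * exp (- (x - p n)\<^sup>2 / 2))"
    using a by (intro summable_times_exp_nonpos) auto
  have "norm (?F z) \<le> exp (r\<^sup>2) * ?H" if "norm (complex_of_real x - z) = r" for z
    unfolding gaussian_superposition_def suminf_mult[OF sum, symmetric]
    using that a sum
    by (intro norm_suminf_le summable_mult gaussian_superposition_term_le)
      (auto simp: norm_minus_commute)
  then have "norm ((deriv ^^ k) ?F (complex_of_real x)) \<le> fact k * (exp (r\<^sup>2) * ?H) / r ^ k"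
    using r hol
    by (intro Cauchy_inequality)
      (auto intro: holomorphic_on_subset holomorphic_on_imp_continuous_on)
  then show ?thesis
    by simp
qed

lemma gaussian_superposition_ge:
  assumes a: "\<And>n. 0 \<le> a n" "summable a"
  shows "a n \<le> norm (gaussian_superposition a p (complex_of_real (p n)))"
proof -
  let ?g = "\<lambda>k. a k * exp (- (p n - p k)\<^sup>2)"
  have sum: "summable ?g"
    using a by (intro summable_times_exp_nonpos) auto
  have "a n = (\<Sum>k\<in>{n}. ?g k)"
    by simp
  also have "\<dots> \<le> suminf ?g"
    using sum a by (intro sum_le_suminf) auto
  also have "\<dots> \<le> norm (complex_of_real (suminf ?g))"
    by simp
  also have "complex_of_real (suminf ?g) = gaussian_superposition a p (complex_of_real (p n))"
    unfolding gaussian_superposition_def suminf_of_real[OF sum]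
    by (simp add: exp_of_real[symmetric])
  finally show ?thesis .
qed


section \<open>Subquadratic growth puts Gaussians into the Beurling class\<close>

lemma subquadratic_weight_bound:
  assumes \<omega>: "general_weight_function \<omega>" and "\<omega> \<in> o[at_top](\<lambda>t. t\<^sup>2)" and c: "0 < c"
  obtains D where "0 \<le> D" "\<And>t. 0 \<le> t \<Longrightarrow> \<omega> t \<le> c * t\<^sup>2 + D"
proof -
  have "eventually (\<lambda>t. norm (\<omega> t) \<le> c * norm (t\<^sup>2)) at_top"
    using assms(2) c by (rule landau_o.smallD)
  then obtain X where X: "\<And>t. X \<le> t \<Longrightarrow> \<bar>\<omega> t\<bar> \<le> c * t\<^sup>2"
    by (auto simp: eventually_at_top_linorder)
  have nonneg: "0 \<le> \<omega> \<bar>X\<bar>"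
    by (rule general_weight_function_nonneg[OF \<omega>]) simp
  have "\<omega> t \<le> c * t\<^sup>2 + \<omega> \<bar>X\<bar>" if t: "0 \<le> t" for t
  proof (cases "X \<le> t")
    case True
    then show ?thesis
      using X[OF True] nonneg by linarith
  next
    case False
    then have "\<omega> t \<le> \<omega> \<bar>X\<bar>"
      using t by (intro general_weight_function_mono[OF \<omega>]) auto
    moreover have "0 \<le> c * t\<^sup>2"
      using c by simp
    ultimately show ?thesis
      by linarith
  qed
  with nonneg show ?thesis
    by (rule that)
qed

text \<open>Cauchy's estimate with \<open>r = \<surd>k\<close> is of order \<open>\<surd>(k!)\<close> up to a geometric factor. Testing the weight
  sequence at \<open>R = e\<^sup>2\<surd>k\<close> gains \<open>e\<^bsup>2k\<^esup>\<close> over \<open>k!/r\<^sup>k \<le> (k/r)\<^sup>k\<close>, and this pays for both \<open>e\<^bsup>r\<^sup>2\<^esup> = e\<^sup>k\<close> and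
  \<open>e\<^bsup>\<omega>(R)/\<mu>\<^esup> = O(e\<^sup>k)\<close>; the latter uses \<open>\<omega>(R) \<le> \<mu>e\<^bsup>-4\<^esup>R\<^sup>2 + D\<close>.\<close>

lemma Cauchy_factor_le_weight_seq:
  assumes \<omega>: "general_weight_function \<omega>" and small: "\<omega> \<in> o[at_top](\<lambda>t. t\<^sup>2)" and \<mu>: "0 < \<mu>"
  obtains C where "0 \<le> C" "\<And>\<beta>. \<exists>r>0.
    fact (multi_abs d \<beta>) * exp (r\<^sup>2) / r ^ multi_abs d \<beta> \<le> C * weight_seq \<omega> d \<mu> \<beta>"
proof -
  obtain D where D: "0 \<le> D" "\<And>t. 0 \<le> t \<Longrightarrow> \<omega> t \<le> \<mu> * exp (- 4) * t\<^sup>2 + D"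
    using subquadratic_weight_bound[OF \<omega> small, of "\<mu> * exp (- 4)"] \<mu> by auto
  define C where "C = exp (1 + \<omega> 1 / \<mu>) + exp (D / \<mu>)"
  have "\<exists>r>0. fact (multi_abs d \<beta>) * exp (r\<^sup>2) / r ^ multi_abs d \<beta> \<le> C * weight_seq \<omega> d \<mu> \<beta>" for \<beta>
  proof -
    define k where "k = multi_abs d \<beta>"
    define W where "W = weight_seq \<omega> d \<mu> \<beta>"
    have W: "0 < W"
      unfolding W_def by (rule weight_seq_pos)
    have low: "R ^ k \<le> exp (\<omega> R / \<mu>) * W" if "1 \<le> R" for R
      unfolding k_def W_def using that by (rule power_le_weight_seq[OF \<omega> \<mu>])
    show ?thesis
    proof (cases "k = 0")
      case True
      \<comment> \<open>The radius \<open>\<surd>k\<close> degenerates, and \<open>r = 1\<close> serves instead.\<close>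
      have "exp 1 * 1 \<le> exp 1 * (exp (\<omega> 1 / \<mu>) * W)"
        using low[of 1] by (intro mult_left_mono) auto
      also have "\<dots> = exp (1 + \<omega> 1 / \<mu>) * W"
        by (simp add: exp_add)
      also have "\<dots> \<le> C * W"
        unfolding C_def using W by (intro mult_right_mono) auto
      finally show ?thesis
        using True by (intro exI[of _ 1]) (simp add: k_def W_def)
    next
      case False
      define r where "r = sqrt (real k)"
      define R where "R = exp 2 * r"
      have r: "1 \<le> r" "r\<^sup>2 = real k"
        using False by (auto simp: r_def)
      have "1 * 1 \<le> exp 2 * r"
        using r by (intro mult_mono) auto
      then have R: "1 \<le> R"
        by (simp add: R_def)
      have "exp (- 4) * R\<^sup>2 = exp (- 4) * exp 4 * real k"
        by (simp add: R_def power_mult_distrib r exp_double[symmetric] mult.assoc)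
      also have "\<dots> = real k"
        by (simp flip: exp_add)
      finally have R2: "exp (- 4) * R\<^sup>2 = real k" .
      have "\<omega> R \<le> \<mu> * (exp (- 4) * R\<^sup>2) + D"
        using D(2)[of R] R by (simp add: mult.assoc)
      then have "\<omega> R / \<mu> \<le> real k + D / \<mu>"
        unfolding R2 using \<mu> by (simp add: field_simps)
      then have "exp (\<omega> R / \<mu>) \<le> exp (real k + D / \<mu>)"
        by simp
      then have Rk: "R ^ k \<le> exp (real k + D / \<mu>) * W"
        using low[OF R] W by (meson less_imp_le mult_right_mono order_trans)
      have "fact k * exp (r\<^sup>2) / r ^ k \<le> real (k ^ k) * exp (r\<^sup>2) / r ^ k"
        using r by (intro divide_right_mono mult_right_mono fact_le_power) auto
      also have "\<dots> = r ^ k * exp (real k)"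
      proof -
        have "real (k ^ k) = r ^ k * r ^ k"
          using r(2) by (simp add: power_mult_distrib[symmetric] power2_eq_square)
        then show ?thesis
          using r by simp
      qed
      also have "\<dots> = exp (- 2 * real k) * R ^ k * exp (real k)"
        by (simp add: R_def power_mult_distrib exp_of_nat2_mult[symmetric] mult.assoc[symmetric]
            exp_add[symmetric])
      also have "exp (- 2 * real k) * R ^ k * exp (real k) \<le>
          exp (- 2 * real k) * (exp (real k + D / \<mu>) * W) * exp (real k)"
        using Rk by (intro mult_right_mono mult_left_mono) auto
      also have "\<dots> = exp (- 2 * real k + (real k + D / \<mu>) + real k) * W"
        unfolding exp_add by (simp only: mult_ac)
      also have "\<dots> = exp (D / \<mu>) * W"
        by simp
      also have "\<dots> \<le> C * W"
        unfolding C_def using W by (intro mult_right_mono) auto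
      finally show ?thesis
        using r by (intro exI[of _ r]) (simp add: k_def W_def)
    qed
  qed
  then show ?thesis
    by (intro that[of C]) (auto simp: C_def add_nonneg_nonneg)
qed

text \<open>With \<open>y = \<bar>x - p\<^sub>n\<bar>\<close> one has \<open>\<bar>x\<bar> \<le> 2 max(y, p\<^sub>n)\<close>, hence \<open>\<omega>(\<bar>x\<bar>) \<le> \<omega>(2y) + \<omega>(2p\<^sub>n)\<close>. The Gaussian absorbs the first summand by
  subquadratic growth, the coefficient \<open>e\<^bsup>-n\<omega>(p\<^sub>n)\<^esup>\<close> absorbs the second by \<open>\<omega>(2t) \<le> L(\<omega>(t) + 1)\<close>; the
  factor \<open>n\<close> in the exponent eventually beats \<open>L / \<mu>\<close> whatever \<open>\<mu>\<close> is.\<close>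

lemma moments_gaussian_weights_le:
  assumes \<omega>: "general_weight_function \<omega>" and small: "\<omega> \<in> o[at_top](\<lambda>t. t\<^sup>2)" and \<mu>: "0 < \<mu>"
    and p: "\<And>n. 1 \<le> p n" "\<And>n. real n \<le> \<omega> (p n)"
    and a_def: "a = (\<lambda>n. exp (- (real n * \<omega> (p n))))" and a: "summable a"
  obtains M where "0 \<le> M" "\<And>x \<alpha>. \<bar>x\<bar> ^ multi_abs d \<alpha> * (\<Sum>n. a n * exp (- (x - p n)\<^sup>2 / 2)) \<le>
    M * weight_seq \<omega> d \<mu> \<alpha>"
proof -
  obtain L where L: "\<And>t. 0 \<le> t \<Longrightarrow> \<omega> (2 * t) \<le> L * (\<omega> t + 1)"
    using \<omega> by (auto simp: general_weight_function_def)
  \<comment> \<open>The factor \<open>1/8\<close> makes \<open>\<omega>(2y)/\<mu>\<close> at most \<open>y\<^sup>2/2\<close>, up to a constant, which is the Gaussian exponent.\<close>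
  obtain D where D: "0 \<le> D" "\<And>t. 0 \<le> t \<Longrightarrow> \<omega> t \<le> \<mu> / 8 * t\<^sup>2 + D"
    using subquadratic_weight_bound[OF \<omega> small, of "\<mu> / 8"] \<mu> by auto
  define b where "b = (\<lambda>n. exp (L * (\<omega> (p n) + 1) / \<mu> - real n * \<omega> (p n)))"
  have b: "summable b"
  proof (rule summable_comparison_test')
    show "summable (\<lambda>n. exp (L / \<mu>) * exp (- 1 :: real) ^ n)"
      by (intro summable_mult summable_geometric) simp
    fix n
    assume n: "nat \<lceil>L / \<mu> + 1\<rceil> \<le> n"
    then have "L / \<mu> + 1 \<le> real n"
      by linarith
    then have "(L / \<mu> + 1) * \<omega> (p n) \<le> real n * \<omega> (p n)"
      using p(2)[of n] by (intro mult_right_mono) auto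
    then have "L * (\<omega> (p n) + 1) / \<mu> - real n * \<omega> (p n) \<le> L / \<mu> - real n"
      using p(2)[of n] by (simp add: add_divide_distrib algebra_simps)
    then have "b n \<le> exp (L / \<mu> - real n)"
      by (simp add: b_def)
    also have "\<dots> = exp (L / \<mu>) * exp (- 1) ^ n"
      by (simp add: exp_of_nat_mult[symmetric] flip: exp_add)
    finally show "norm (b n) \<le> exp (L / \<mu>) * exp (- 1) ^ n"
      by (simp add: b_def)
  qed
  define M where "M = exp (D / \<mu>) * suminf b"
  have "\<bar>x\<bar> ^ multi_abs d \<alpha> * (\<Sum>n. a n * exp (- (x - p n)\<^sup>2 / 2)) \<le> M * weight_seq \<omega> d \<mu> \<alpha>" for x \<alpha>
  proof -
    define W where "W = weight_seq \<omega> d \<mu> \<alpha>"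
    let ?k = "multi_abs d \<alpha>" and ?h = "\<lambda>n. a n * exp (- (x - p n)\<^sup>2 / 2)"
    have W: "0 < W"
      unfolding W_def by (rule weight_seq_pos)
    have sum: "summable ?h"
      using a by (intro summable_times_exp_nonpos) (auto simp: a_def)
    have le: "\<bar>x\<bar> ^ ?k * ?h n \<le> (exp (D / \<mu>) * W) * b n" for n
    proof -
      \<comment> \<open>The supremum in the Young conjugate runs over \<open>t \<ge> 0\<close> and thus sees only points \<open>e\<^sup>t \<ge> 1\<close>.\<close>
      define R where "R = max 1 \<bar>x\<bar>"
      define y where "y = \<bar>x - p n\<bar>"
      have "\<bar>x\<bar> \<le> y + p n"
        using p(1)[of n] by (simp add: y_def)
      then have "R \<le> 2 * max y (p n)"
        using p(1)[of n] by (simp add: R_def max_def)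
      then have "\<omega> R \<le> \<omega> (2 * max y (p n))"
        by (intro general_weight_function_mono[OF \<omega>]) (auto simp: R_def)
      also have "\<dots> \<le> \<omega> (2 * y) + \<omega> (2 * p n)"
        using general_weight_function_nonneg[OF \<omega>, of "2 * y"]
          general_weight_function_nonneg[OF \<omega>, of "2 * p n"] p(1)[of n]
        by (simp add: max_def y_def)
      also have "\<dots> \<le> (\<mu> / 8 * (2 * y)\<^sup>2 + D) + L * (\<omega> (p n) + 1)"
        using p(1)[of n] by (intro add_mono D L) (auto simp: y_def)
      finally have "\<omega> R / \<mu> \<le> ((\<mu> / 8 * (2 * y)\<^sup>2 + D) + L * (\<omega> (p n) + 1)) / \<mu>"
        using \<mu> by (intro divide_right_mono) auto
      also have "\<dots> = (x - p n)\<^sup>2 / 2 + D / \<mu> + L * (\<omega> (p n) + 1) / \<mu>"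
        using \<mu> by (simp add: add_divide_distrib y_def power_mult_distrib)
      finally have exponent: "\<omega> R / \<mu> + (- (real n * \<omega> (p n)) + - (x - p n)\<^sup>2 / 2) \<le>
          D / \<mu> + (L * (\<omega> (p n) + 1) / \<mu> - real n * \<omega> (p n))"
        by simp
      have "\<bar>x\<bar> ^ ?k \<le> R ^ ?k"
        by (intro power_mono) (auto simp: R_def)
      also have "\<dots> \<le> exp (\<omega> R / \<mu>) * W"
        unfolding W_def by (intro power_le_weight_seq \<omega> \<mu>) (simp add: R_def)
      finally have "\<bar>x\<bar> ^ ?k * ?h n \<le> exp (\<omega> R / \<mu>) * W * ?h n"
        by (intro mult_right_mono) (auto simp: a_def)
      also have "\<dots> = exp (\<omega> R / \<mu> + (- (real n * \<omega> (p n)) + - (x - p n)\<^sup>2 / 2)) * W"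
        unfolding a_def exp_add by (simp only: mult_ac)
      also have "\<dots> \<le> exp (D / \<mu> + (L * (\<omega> (p n) + 1) / \<mu> - real n * \<omega> (p n))) * W"
        using exponent W by (intro mult_right_mono) auto
      also have "\<dots> = (exp (D / \<mu>) * W) * b n"
        unfolding b_def exp_add by (simp only: mult_ac)
      finally show ?thesis .
    qed
    have "\<bar>x\<bar> ^ ?k * suminf ?h = (\<Sum>n. \<bar>x\<bar> ^ ?k * ?h n)"
      using sum by (rule suminf_mult[symmetric])
    also have "\<dots> \<le> (\<Sum>n. (exp (D / \<mu>) * W) * b n)"
      using le sum b by (intro suminf_le summable_mult)
    also have "\<dots> = (exp (D / \<mu>) * W) * suminf b"
      using b by (rule suminf_mult)
    finally show ?thesis
      by (simp add: M_def W_def mult_ac)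
  qed
  moreover have "0 \<le> M"
    using suminf_nonneg[OF b] by (simp add: M_def b_def)
  ultimately show ?thesis
    using that by blast
qed

lemma gaussian_superposition_in_S_space:
  assumes \<omega>: "general_weight_function \<omega>" and small: "\<omega> \<in> o[at_top](\<lambda>t. t\<^sup>2)"
    and p: "\<And>n. 1 \<le> p n" "\<And>n. real n \<le> \<omega> (p n)"
    and a_def: "a = (\<lambda>n. exp (- (real n * \<omega> (p n))))" and a: "summable a"
  shows "restrict_to_line (gaussian_superposition a p) \<in> S_space g \<omega> 1"
proof -
  let ?F = "gaussian_superposition a p"
  have a_nonneg: "0 \<le> a n" for n
    by (simp add: a_def)
  have hol: "?F holomorphic_on UNIV"
    using a_nonneg a by (rule holomorphic_gaussian_superposition)
  have "S_seminorm g \<omega> 1 \<mu> (restrict_to_line ?F) < \<infinity>" if \<mu>: "0 < \<mu>" for \<mu>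
  proof -
    obtain C where C: "0 \<le> C" "\<And>\<beta>. \<exists>r>0. fact (multi_abs 1 \<beta>) * exp (r\<^sup>2) / r ^ multi_abs 1 \<beta> \<le>
        C * weight_seq \<omega> 1 \<mu> \<beta>"
      using Cauchy_factor_le_weight_seq[OF \<omega> small \<mu>, of 1] by blast
    obtain M where M: "0 \<le> M" "\<And>x \<alpha>. \<bar>x\<bar> ^ multi_abs 1 \<alpha> *
        (\<Sum>n. a n * exp (- (x - p n)\<^sup>2 / 2)) \<le> M * weight_seq \<omega> 1 \<mu> \<alpha>"
      using moments_gaussian_weights_le[OF \<omega> small \<mu> p a_def a, of 1] by blast
    have "S_seminorm g \<omega> 1 \<mu> (restrict_to_line ?F) \<le> ennreal (M * C)"
      unfolding S_seminorm_le_iff[OF mult_nonneg_nonneg[OF M(1) C(1)]]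
    proof (intro ballI)
      fix \<alpha> \<beta> :: "nat \<Rightarrow> nat" and x :: "nat \<Rightarrow> real"
      assume x: "x \<in> topspace (Euclidean_space 1)"
      define H where "H = (\<Sum>n. a n * exp (- (x 0 - p n)\<^sup>2 / 2))"
      have H: "0 \<le> H"
        unfolding H_def using a_nonneg a
        by (intro suminf_nonneg summable_times_exp_nonpos) auto
      obtain r where r: "0 < r" "fact (\<beta> 0) * exp (r\<^sup>2) / r ^ \<beta> 0 \<le> C * weight_seq \<omega> 1 \<mu> \<beta>"
        using C(2)[of \<beta>] by (auto simp: multi_abs_def)
      have "norm (multi_deriv 1 \<beta> (restrict_to_line ?F) x) =
          norm ((deriv ^^ \<beta> 0) ?F (complex_of_real (x 0)))"
        using x by (simp only: multi_deriv_restrict_to_line[OF hol])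
          (simp add: restrict_to_line_def)
      also have "\<dots> \<le> fact (\<beta> 0) * exp (r\<^sup>2) / r ^ \<beta> 0 * H"
        unfolding H_def using a_nonneg a r(1) by (rule higher_deriv_gaussian_superposition_le)
      also have "\<dots> \<le> C * weight_seq \<omega> 1 \<mu> \<beta> * H"
        using r(2) H by (rule mult_right_mono)
      finally have "\<bar>multi_power 1 x \<alpha>\<bar> * norm (multi_deriv 1 \<beta> (restrict_to_line ?F) x) \<le>
          \<bar>x 0\<bar> ^ \<alpha> 0 * (C * weight_seq \<omega> 1 \<mu> \<beta> * H)"
        by (intro mult_mono) (auto simp: multi_power_def power_abs)
      also have "\<dots> = (C * weight_seq \<omega> 1 \<mu> \<beta>) * (\<bar>x 0\<bar> ^ \<alpha> 0 * H)"
        by (simp only: mult_ac)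
      also have "\<dots> \<le> (C * weight_seq \<omega> 1 \<mu> \<beta>) * (M * weight_seq \<omega> 1 \<mu> \<alpha>)"
        using M(2)[of "x 0" \<alpha>] C(1) weight_seq_pos[of \<omega> 1 \<mu> \<beta>] unfolding H_def
        by (intro mult_left_mono) (auto simp: multi_abs_def)
      also have "\<dots> = (M * C) * (weight_seq \<omega> 1 \<mu> \<alpha> * weight_seq \<omega> 1 \<mu> \<beta>)"
        by (simp only: mult_ac)
      also have "\<dots> \<le> (M * C) * growth_weight g \<omega> 1 \<mu> \<alpha> \<beta>"
        using M(1) C(1) by (intro mult_left_mono weight_seq_product_le_growth_weight \<omega> \<mu>) auto
      finally show "\<bar>multi_power 1 x \<alpha>\<bar> * norm (multi_deriv 1 \<beta> (restrict_to_line ?F) x) \<le>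
          M * C * growth_weight g \<omega> 1 \<mu> \<alpha> \<beta>" .
    qed
    then show ?thesis
      by (simp add: le_less_trans)
  qed
  then show ?thesis
    using smooth_fun_restrict_to_line[OF hol] by (simp add: S_space_def restrict_to_line_def)
qed


section \<open>Inclusion in dimension one forces domination of the weights\<close>

text \<open>Choosing the exponent from the biconjugate estimate turns the bounds on all \<open>x\<^sup>k f(x)\<close> into the
  pointwise decay of \<open>f\<close> that the weight function prescribes.\<close>

lemma S_space_decay:
  assumes \<sigma>: "general_weight_function \<sigma>" and f: "f \<in> S_space g \<sigma> 1"
  obtains M where "0 \<le> M" "\<And>x. x \<in> topspace (Euclidean_space 1) \<Longrightarrow> 1 < x 0 \<Longrightarrow>
    norm (f x) \<le> M * exp (ln (x 0) - \<sigma> (x 0))"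
proof -
  have "S_seminorm g \<sigma> 1 1 f < \<infinity>"
    using f by (simp add: S_space_def)
  then obtain M where M: "0 \<le> M" "S_seminorm g \<sigma> 1 1 f \<le> ennreal M"
    by (cases "S_seminorm g \<sigma> 1 1 f") auto
  have "norm (f x) \<le> M * exp (ln (x 0) - \<sigma> (x 0))"
    if x: "x \<in> topspace (Euclidean_space 1)" "1 < x 0" for x
  proof -
    obtain k where k: "\<sigma> (x 0) - ln (x 0) \<le> real k * ln (x 0) - young_conj \<sigma> (real k)"
      using young_conj_biconjugate_nat[OF \<sigma> x(2)] .
    define \<alpha> :: "nat \<Rightarrow> nat" where "\<alpha> = (\<lambda>i. if i = 0 then k else 0)"
    have "\<bar>multi_power 1 x \<alpha>\<bar> * norm (multi_deriv 1 (\<lambda>i. 0) f x) \<le>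
        M * growth_weight g \<sigma> 1 1 \<alpha> (\<lambda>i. 0)"
      using M(2) x(1) unfolding S_seminorm_le_iff[OF M(1)]
      by (auto simp: multi_indices_def \<alpha>_def)
    also have "\<dots> \<le> M * weight_seq \<sigma> 1 1 \<alpha>"
      using M(1) by (intro mult_left_mono growth_weight_zero_le \<sigma>) auto
    finally have "x 0 ^ k * norm (f x) \<le> M * exp (young_conj \<sigma> (real k))"
      using x(2)
      by (simp add: multi_power_def multi_deriv_def iter_partial_def weight_seq_def multi_abs_def \<alpha>_def)
    moreover have "x 0 ^ k = exp (real k * ln (x 0))"
      using x(2) by (simp add: exp_of_nat_mult)
    ultimately have "norm (f x) \<le> M * exp (young_conj \<sigma> (real k)) / exp (real k * ln (x 0))"
      by (simp add: pos_le_divide_eq mult.commute)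
    also have "\<dots> = M * exp (young_conj \<sigma> (real k) - real k * ln (x 0))"
      by (simp add: exp_diff)
    also have "\<dots> \<le> M * exp (ln (x 0) - \<sigma> (x 0))"
      using k M(1) by (intro mult_left_mono) auto
    finally show ?thesis .
  qed
  with M(1) show ?thesis
    by (rule that)
qed

text \<open>The two lower bounds on \<open>\<omega>(p\<^sub>n)\<close> hold for all large arguments. The first one makes the coefficients
  \<open>e\<^bsup>-n\<omega>(p\<^sub>n)\<^esup>\<close> summable, the second one makes the factor \<open>p\<^sub>n\<close> in the decay estimate harmless.\<close>

lemma not_bigo_witnesses:
  assumes \<omega>: "general_weight_function \<omega>" and \<sigma>: "general_weight_function \<sigma>"
    and not: "\<sigma> \<notin> O[at_top](\<omega>)"
  obtains p :: "nat \<Rightarrow> real" where "\<And>n. 2 \<le> p n" "\<And>n. real n \<le> \<omega> (p n)" "\<And>n. ln (p n) \<le> \<omega> (p n)"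
    "\<And>n. (real n + 2) * \<omega> (p n) \<le> \<sigma> (p n)"
proof -
  have "ln \<in> o[at_top](\<omega>)"
    using \<omega> by (simp add: general_weight_function_def)
  then have "eventually (\<lambda>x. norm (ln x) \<le> 1 * norm (\<omega> x)) at_top"
    by (rule landau_o.smallD) simp
  then have ln: "eventually (\<lambda>x. ln x \<le> \<omega> x) at_top"
    using eventually_ge_at_top[of 1]
    by eventually_elim (simp add: general_weight_function_nonneg[OF \<omega>])
  have "\<exists>x\<ge>2. real n \<le> \<omega> x \<and> ln x \<le> \<omega> x \<and> (real n + 2) * \<omega> x \<le> \<sigma> x" for n
  proof (rule ccontr)
    assume contra: "\<not> ?thesis"
    have "eventually (\<lambda>x. real n \<le> ln x) at_top"
      using ln_at_top by (simp add: filterlim_at_top)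
    then have "eventually (\<lambda>x. norm (\<sigma> x) \<le> (real n + 2) * norm (\<omega> x)) at_top"
      using ln eventually_ge_at_top[of 2]
    proof eventually_elim
      case (elim x)
      then have "\<sigma> x \<le> (real n + 2) * \<omega> x"
        using contra by (meson le_cases order_trans)
      then show ?case
        using elim(3) general_weight_function_nonneg[OF \<sigma>, of x]
          general_weight_function_nonneg[OF \<omega>, of x] by simp
    qed
    then have "\<sigma> \<in> O[at_top](\<omega>)"
      by (rule landau_o.bigI[rotated]) simp
    with not show False
      by contradiction
  qed
  then show ?thesis
    using that by metis
qed

text \<open>Membership of the superposition in the \<open>\<sigma>\<close>-space would bound its value at \<open>p\<^sub>n\<close> by a constant times
  \<open>p\<^sub>n e\<^bsup>-\<sigma>(p\<^sub>n)\<^esup> \<le> e\<^bsup>-(n + 1)\<omega>(p\<^sub>n)\<^esup>\<close>, which is smaller than the coefficient \<open>e\<^bsup>-n\<omega>(p\<^sub>n)\<^esup>\<close> by the unbounded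
  factor \<open>e\<^bsup>\<omega>(p\<^sub>n)\<^esup>\<close>.\<close>

lemma bigo_if_S_space_subset:
  assumes \<omega>: "general_weight_function \<omega>" and \<sigma>: "general_weight_function \<sigma>"
    and small: "\<omega> \<in> o[at_top](\<lambda>t. t\<^sup>2)" and sub: "S_space g \<omega> 1 \<subseteq> S_space g \<sigma> 1"
  shows "\<sigma> \<in> O[at_top](\<omega>)"
proof (rule ccontr)
  assume "\<sigma> \<notin> O[at_top](\<omega>)"
  then obtain p :: "nat \<Rightarrow> real" where p: "\<And>n. 2 \<le> p n" "\<And>n. real n \<le> \<omega> (p n)"
    "\<And>n. ln (p n) \<le> \<omega> (p n)" "\<And>n. (real n + 2) * \<omega> (p n) \<le> \<sigma> (p n)"
    using not_bigo_witnesses[OF \<omega> \<sigma>] by metis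
  define a where "a = (\<lambda>n. exp (- (real n * \<omega> (p n))))"
  let ?F = "gaussian_superposition a p"
  have a: "summable a"
  proof (rule summable_comparison_test')
    show "summable (\<lambda>n. exp (- 1 :: real) ^ n)"
      by (intro summable_geometric) simp
    fix n :: nat
    have "real n * 1 \<le> real n * \<omega> (p n)"
      using p(2)[of n] by (cases n) (auto intro!: mult_left_mono)
    then show "norm (a n) \<le> exp (- 1) ^ n"
      by (simp add: a_def exp_of_nat_mult[symmetric])
  qed
  have "1 \<le> p n" for n
    using p(1)[of n] by simp
  then have "restrict_to_line ?F \<in> S_space g \<omega> 1"
    using p(2) by (intro gaussian_superposition_in_S_space \<omega> small a_def a)
  then obtain M where M: "0 \<le> M" "\<And>x. x \<in> topspace (Euclidean_space 1) \<Longrightarrow> 1 < x 0 \<Longrightarrow>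
      norm (restrict_to_line ?F x) \<le> M * exp (ln (x 0) - \<sigma> (x 0))"
    using S_space_decay[OF \<sigma>] sub by blast
  have "exp (real n) \<le> M" for n
  proof -
    define x :: "nat \<Rightarrow> real" where "x = (\<lambda>i. if i = 0 then p n else 0)"
    have x: "x \<in> topspace (Euclidean_space 1)" "x 0 = p n"
      by (auto simp: x_def topspace_Euclidean_space)
    have "a n \<le> norm (?F (complex_of_real (p n)))"
      using a by (intro gaussian_superposition_ge) (simp add: a_def)
    also have "\<dots> = norm (restrict_to_line ?F x)"
      using x by (simp add: restrict_to_line_def)
    also have "\<dots> \<le> M * exp (ln (p n) - \<sigma> (p n))"
      using M(2)[OF x(1)] x(2) p(1)[of n] by simp
    also have "\<dots> \<le> M * exp (- real n - real n * \<omega> (p n))"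
      using M(1) p(2-4)[of n] by (intro mult_left_mono) (auto simp: algebra_simps)
    also have "\<dots> = M * exp (- real n) * a n"
      by (simp add: a_def exp_diff exp_minus field_simps)
    finally have "1 * a n \<le> (M * exp (- real n)) * a n"
      by simp
    then have "1 \<le> M * exp (- real n)"
      by (rule mult_right_le_imp_le) (simp add: a_def)
    then show ?thesis
      by (simp add: exp_minus field_simps)
  qed
  moreover obtain n :: nat where "M < real n"
    using reals_Archimedean2 by blast
  then have "M < exp (real n)"
    using exp_ge_add_one_self[of "real n"] by linarith
  ultimately show False
    using leD by blast
qed

theorem theorem4p3:
  fixes \<omega> \<sigma> :: "real \<Rightarrow> real"
  shows
    "(weight_function \<omega> \<and> weight_function \<sigma> \<and>
        \<omega> \<in> o[at_top](\<lambda>t. t\<^sup>2) \<and> \<sigma> \<in> o[at_top](\<lambda>t. t\<^sup>2) \<longrightarrow>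
        (\<forall>g. (\<sigma> \<in> O[at_top](\<omega>) \<longleftrightarrow> (\<forall>d\<ge>1. continuous_inclusion g \<omega> \<sigma> d)) \<and>
             (S_space g \<omega> 1 \<subseteq> S_space g \<sigma> 1 \<longrightarrow> \<sigma> \<in> O[at_top](\<omega>))))
   \<and> (general_weight_function \<omega> \<and> general_weight_function \<sigma> \<and> \<sigma> \<in> O[at_top](\<omega>) \<longrightarrow>
        (\<forall>g. \<forall>d\<ge>1. continuous_inclusion g \<omega> \<sigma> d))"
proof (intro conjI impI allI)
  fix g
  assume *: "weight_function \<omega> \<and> weight_function \<sigma> \<and>
    \<omega> \<in> o[at_top](\<lambda>t. t\<^sup>2) \<and> \<sigma> \<in> o[at_top](\<lambda>t. t\<^sup>2)"
  then have \<omega>: "general_weight_function \<omega>" and \<sigma>: "general_weight_function \<sigma>"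
    and small: "\<omega> \<in> o[at_top](\<lambda>t. t\<^sup>2)"
    by (auto simp: weight_function_def)
  show converse: "\<sigma> \<in> O[at_top](\<omega>)" if "S_space g \<omega> 1 \<subseteq> S_space g \<sigma> 1"
    using bigo_if_S_space_subset[OF \<omega> \<sigma> small that] .
  show "\<sigma> \<in> O[at_top](\<omega>) \<longleftrightarrow> (\<forall>d\<ge>1. continuous_inclusion g \<omega> \<sigma> d)"
    using continuous_inclusion_if_bigo[OF \<omega> \<sigma>] converse
    by (auto simp: continuous_inclusion_def)
next
  fix g and d :: nat
  assume "general_weight_function \<omega> \<and> general_weight_function \<sigma> \<and> \<sigma> \<in> O[at_top](\<omega>)"
  then show "continuous_inclusion g \<omega> \<sigma> d"
    by (blast intro: continuous_inclusion_if_bigo)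
qed

end
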